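(* Let $R$ be a finite noncommutative ring and let $r\in K(R)$. Then $\Gamma_R^r$ is a star graph if and only if $R$ is isomorphic to $E(4)$ or $F(4)$.
   Context: Rings are associative and not assumed to have a unity. $[x,y]:=xy-yx$ and $K(R):=\{[x,y]:x,y\in R\}$. The $r$-noncommuting graph $\Gamma_R^r$ is the simple undirected graph with vertex set $R$ in which two distinct vertices $x,y$ are adjacent if and only if $[x,y]\neq r$ and $[x,y]\neq -r$. A star graph is a complete bipartite graph $K_{1,n}$ with $n\ge 1$. $E(4)=\langle a,b: 2a=2b=0,\ a^2=a,\ b^2=b,\ ab=a,\ ba=b\rangle$ and $F(4)=\langle a,b: 2a=2b=0,\ a^2=a,\ b^2=b,\ ab=b,\ ba=a\rangle$; these are (non-unital) rings of order $4$ whose additive group is $(\mathbb{Z}/2)a\oplus(\mathbb{Z}/2)b$, with multiplication determined bilinearly by the given relations.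
   Formalization: The condition r ≠ 0 is added to the right-hand side: for r = 0, which lies in K(R), the vertex 0 is isolated, so the graph is never a star, even when R is E(4) or F(4). *)

theory Defs
  imports "HOL-Library.Z2" "Graph_Theory.Kuratowski"
begin

text \<open>
  The type class \<open>ring\<close> requires associativity and distributivity but no unity, so it is
  the right notion of ring here; the ring is the whole type.
\<close>

definition commutator :: "'a::ring \<Rightarrow> 'a \<Rightarrow> 'a" where
  "commutator x y = x * y - y * x"

definition commutator_set :: "'a::ring set" where
  "commutator_set = {commutator x y | x y. True}"

text \<open>
  A simple undirected graph is represented, as in the locale \<open>pair_graph\<close>, by a
  symmetric irreflexive arc relation.  The relation below is symmetric because
  \<open>commutator y x = - commutator x y\<close>.
\<close>

definition noncommuting_graph :: "'a::ring \<Rightarrow> 'a pair_pre_digraph" where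
  "noncommuting_graph r =
     \<lparr>pverts = UNIV,
      parcs = {(x, y). x \<noteq> y \<and> commutator x y \<noteq> r \<and> commutator x y \<noteq> - r}\<rparr>"

lemma pair_graph_noncommuting_graph:
  "pair_graph (noncommuting_graph (r :: 'a::{ring, finite}))"
proof -
  have "commutator y x = - commutator x y" for x y :: 'a
    by (simp add: commutator_def)
  then have swap: "commutator y x = r \<longleftrightarrow> commutator x y = - r"
      "commutator y x = - r \<longleftrightarrow> commutator x y = r" for x y :: 'a
    by (metis minus_minus)+
  have "symmetric (noncommuting_graph r)"
    unfolding symmetric_def with_proj_simps
  proof (rule symI)
    fix x y assume "(x, y) \<in> parcs (noncommuting_graph r)"
    then show "(y, x) \<in> parcs (noncommuting_graph r)"
      using swap[of x y] by (auto simp: noncommuting_graph_def)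
  qed
  then show ?thesis
    by unfold_locales (auto simp: noncommuting_graph_def)
qed

text \<open>
  \<open>complete_bipartite_digraph m n\<close> says that the graph is a \<open>K\<^bsub>m,n\<^esub>\<close>;
  it includes simplicity, symmetry and finiteness.
\<close>

definition star_graph :: "('a, 'b) pre_digraph \<Rightarrow> bool" where
  "star_graph G \<longleftrightarrow> (\<exists>n\<ge>1. complete_bipartite_digraph 1 n G)"

definition isomorphic_rings :: "'a::ring itself \<Rightarrow> 'b::ring itself \<Rightarrow> bool" where
  "isomorphic_rings _ _ \<longleftrightarrow>
     (\<exists>f :: 'a \<Rightarrow> 'b. bij f \<and> (\<forall>x y. f (x + y) = f x + f y) \<and> (\<forall>x y. f (x * y) = f x * f y))"

text \<open>
  In both rings below, the pair \<open>(x, y)\<close> of coefficients in \<open>\<int>/2\<close> stands for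
  \<open>x a + y b\<close>, and the product is the bilinear extension of the given products of the
  generators \<open>a\<close> and \<open>b\<close>.
\<close>

datatype E4 = E4 bit bit

instantiation E4 :: ring
begin

definition zero_E4 :: E4 where "0 = E4 0 0"

fun plus_E4 :: "E4 \<Rightarrow> E4 \<Rightarrow> E4" where
  "E4 x1 y1 + E4 x2 y2 = E4 (x1 + x2) (y1 + y2)"

fun uminus_E4 :: "E4 \<Rightarrow> E4" where
  "- E4 x y = E4 (- x) (- y)"

fun minus_E4 :: "E4 \<Rightarrow> E4 \<Rightarrow> E4" where
  "E4 x1 y1 - E4 x2 y2 = E4 (x1 - x2) (y1 - y2)"

fun times_E4 :: "E4 \<Rightarrow> E4 \<Rightarrow> E4" where
  "E4 x1 y1 * E4 x2 y2 = E4 (x1 * x2 + x1 * y2) (y1 * x2 + y1 * y2)"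

instance
proof
  fix u v w :: E4
  show "u + v + w = u + (v + w)"
    by (cases u; cases v; cases w) (simp only: plus_E4.simps times_E4.simps add.assoc)
  show "u + v = v + u"
    by (cases u; cases v) (simp only: plus_E4.simps times_E4.simps add.commute)
  show "0 + u = u"
    by (cases u) (simp add: zero_E4_def)
  show "- u + u = 0"
    by (cases u) (simp add: zero_E4_def)
  show "u - v = u + - v"
    by (cases u; cases v) simp
  show "u * v * w = u * (v * w)"
    by (cases u; cases v; cases w) (simp only: plus_E4.simps times_E4.simps distrib_left distrib_right ac_simps)
  show "(u + v) * w = u * w + v * w"
    by (cases u; cases v; cases w) (simp only: plus_E4.simps times_E4.simps distrib_left distrib_right ac_simps)
  show "u * (v + w) = u * v + u * w"
    by (cases u; cases v; cases w) (simp only: plus_E4.simps times_E4.simps distrib_left distrib_right ac_simps)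
qed

end

lemma E4_presentation:
  defines "a \<equiv> E4 1 0" and "b \<equiv> E4 0 1"
  shows "a + a = 0" "b + b = 0" "a * a = a" "b * b = b" "a * b = a" "b * a = b"
    and "UNIV = {0, a, b, a + b}" "distinct [0, a, b, a + b]"
proof -
  have "u \<in> {0, a, b, a + b}" for u :: E4
  proof (cases u)
    case (E4 x y)
    show ?thesis
      unfolding E4 a_def b_def zero_E4_def by (cases x; cases y; simp)
  qed
  then show "UNIV = {0, a, b, a + b}" by blast
qed (simp_all add: a_def b_def zero_E4_def)

datatype F4 = F4 bit bit

instantiation F4 :: ring
begin

definition zero_F4 :: F4 where "0 = F4 0 0"

fun plus_F4 :: "F4 \<Rightarrow> F4 \<Rightarrow> F4" where
  "F4 x1 y1 + F4 x2 y2 = F4 (x1 + x2) (y1 + y2)"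

fun uminus_F4 :: "F4 \<Rightarrow> F4" where
  "- F4 x y = F4 (- x) (- y)"

fun minus_F4 :: "F4 \<Rightarrow> F4 \<Rightarrow> F4" where
  "F4 x1 y1 - F4 x2 y2 = F4 (x1 - x2) (y1 - y2)"

fun times_F4 :: "F4 \<Rightarrow> F4 \<Rightarrow> F4" where
  "F4 x1 y1 * F4 x2 y2 = F4 (x1 * x2 + y1 * x2) (x1 * y2 + y1 * y2)"

instance
proof
  fix u v w :: F4
  show "u + v + w = u + (v + w)"
    by (cases u; cases v; cases w) (simp only: plus_F4.simps times_F4.simps add.assoc)
  show "u + v = v + u"
    by (cases u; cases v) (simp only: plus_F4.simps times_F4.simps add.commute)
  show "0 + u = u"
    by (cases u) (simp add: zero_F4_def)
  show "- u + u = 0"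
    by (cases u) (simp add: zero_F4_def)
  show "u - v = u + - v"
    by (cases u; cases v) simp
  show "u * v * w = u * (v * w)"
    by (cases u; cases v; cases w) (simp only: plus_F4.simps times_F4.simps distrib_left distrib_right ac_simps)
  show "(u + v) * w = u * w + v * w"
    by (cases u; cases v; cases w) (simp only: plus_F4.simps times_F4.simps distrib_left distrib_right ac_simps)
  show "u * (v + w) = u * v + u * w"
    by (cases u; cases v; cases w) (simp only: plus_F4.simps times_F4.simps distrib_left distrib_right ac_simps)
qed

end

lemma F4_presentation:
  defines "a \<equiv> F4 1 0" and "b \<equiv> F4 0 1"
  shows "a + a = 0" "b + b = 0" "a * a = a" "b * b = b" "a * b = b" "b * a = a"
    and "UNIV = {0, a, b, a + b}" "distinct [0, a, b, a + b]"
proof -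
  have "u \<in> {0, a, b, a + b}" for u :: F4
  proof (cases u)
    case (F4 x y)
    show ?thesis
      unfolding F4 a_def b_def zero_F4_def by (cases x; cases y; simp)
  qed
  then show "UNIV = {0, a, b, a + b}" by blast
qed (simp_all add: a_def b_def zero_F4_def)

text \<open>
  Pitfall: \<open>0\<close> always lies in \<open>commutator_set\<close>, and for \<open>r = 0\<close> the vertex
  \<open>0\<close> is isolated in \<open>noncommuting_graph r\<close>, so that graph is never a star, not
  even for the rings \<open>E4\<close> and \<open>F4\<close>.  A characterization of the star case valid
  for every \<open>r\<close> in \<open>commutator_set\<close> must therefore include \<open>r \<noteq> 0\<close>.
\<close>

end

theory Submission
  imports Defs
begin

text \<open>
  If \<open>r \<noteq> 0\<close>, the vertex \<open>0\<close> is joined to every other one, so a star has centre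
  \<open>0\<close> and any two distinct nonzero elements have commutator \<open>\<plusminus> r\<close>; in particular they do not
  commute.  Comparing \<open>x\<close> with \<open>x + x\<close> and with \<open>x * x\<close> gives characteristic \<open>2\<close> and
  \<open>x * x \<in> {0, x}\<close>.  For distinct nonzero \<open>x, y, z\<close> the commutator of \<open>x\<close> and \<open>y + z\<close> is
  \<open>r + r = 0\<close>, so \<open>z = x + y\<close> and the ring has order \<open>4\<close>.  Not every element is
  idempotent, since a Boolean ring is commutative; so some \<open>x \<noteq> 0\<close> has square \<open>0\<close>.
  For \<open>y\<close> not commuting with \<open>x\<close>, one of \<open>x * y, y * x\<close> is \<open>x\<close> and the other \<open>0\<close>, and
  \<open>a = y\<close>, \<open>b = x + y\<close> are the generators of \<open>E(4)\<close> or of \<open>F(4)\<close>.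
\<close>

section \<open>Star graphs and commutators\<close>

lemma commutator_zero [simp]: "commutator 0 x = 0" "commutator x 0 = 0"
  by (simp_all add: commutator_def)

lemma star_graph_noncommuting_graph_iff:
  fixes r :: "'a::{ring, finite}"
  assumes noncommutative: "\<exists>x y :: 'a. x * y \<noteq> y * x"
  shows "star_graph (with_proj (noncommuting_graph r)) \<longleftrightarrow>
    r \<noteq> 0 \<and> (\<forall>x y. x \<noteq> 0 \<longrightarrow> y \<noteq> 0 \<longrightarrow> x \<noteq> y \<longrightarrow> commutator x y = r \<or> commutator x y = - r)"
    (is "?star \<longleftrightarrow> _ \<and> ?nonadj")
proof -
  obtain p q :: 'a where "p * q \<noteq> q * p"
    using noncommutative by blast
  then have pq: "p \<noteq> 0" "q \<noteq> 0" "p \<noteq> q"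
    by auto
  show ?thesis
  proof (intro iffI conjI)
    assume ?star
    then obtain n U V where "card U = 1" and V: "card V = n" "n \<ge> 1"
      and UV: "UNIV = U \<union> V" "U \<inter> V = {}"
      and arcs: "parcs (noncommuting_graph r) = U \<times> V \<union> V \<times> U"
      by (auto simp: star_graph_def complete_bipartite_digraph_pair_def noncommuting_graph_def)
    obtain c where c: "U = {c}"
      using \<open>card U = 1\<close> card_1_singletonE by blast
    have V_eq: "V = - {c}"
      using UV unfolding c by auto
    \<comment> \<open>In a star with centre \<open>c\<close>, two vertices are adjacent exactly when
      one and only one of them is \<open>c\<close>.\<close>
    have adj: "x \<noteq> y \<and> commutator x y \<noteq> r \<and> commutator x y \<noteq> - r \<longleftrightarrow> (x = c) \<noteq> (y = c)" for x y
    proof -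
      have "(x, y) \<in> parcs (noncommuting_graph r) \<longleftrightarrow> (x = c) \<noteq> (y = c)"
        unfolding arcs c V_eq by auto
      then show ?thesis
        by (simp add: noncommuting_graph_def)
    qed
    obtain d where "d \<noteq> c"
      using pq by metis
    \<comment> \<open>For \<open>r = 0\<close> the vertex \<open>0\<close> would be isolated, but in
      a star it has a neighbour: \<open>d\<close> if \<open>0\<close> is the centre, and
      \<open>c\<close> otherwise.\<close>
    show "r \<noteq> 0"
      using adj[of 0 d] adj[of 0 c] \<open>d \<noteq> c\<close> by (cases "c = 0") auto
    then have "x = 0 \<or> (0 = c) \<noteq> (x = c)" for x
      using adj[of 0 x] by auto
    \<comment> \<open>A centre other than \<open>0\<close> would equal every nonzero element, hence
      both \<open>p\<close> and \<open>q\<close>.\<close>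
    then have "c = 0"
      using pq by metis
    then show ?nonadj
      using adj by metis
  next
    assume R: "r \<noteq> 0 \<and> ?nonadj"
    then have "parcs (noncommuting_graph r) = {0} \<times> (- {0}) \<union> (- {0}) \<times> {0}"
      by (auto simp: noncommuting_graph_def)
    moreover have "card (- {0 :: 'a}) \<ge> 1"
      using pq(1) by (auto simp: Suc_le_eq card_gt_0_iff)
    moreover have "pverts (noncommuting_graph r) = {0} \<union> - {0}"
      by (simp add: noncommuting_graph_def)
    moreover have "{0} \<inter> - {0 :: 'a} = {}" "card {0 :: 'a} = 1"
      by simp_all
    ultimately show ?star
      unfolding star_graph_def complete_bipartite_digraph_pair_def
      using finite[of "pverts (noncommuting_graph r)"] by blast
  qed
qed

section \<open>Recognizing the two rings by generators\<close>

lemma isomorphic_rings_sym: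
  assumes "isomorphic_rings TYPE('a::ring) TYPE('b::ring)"
  shows "isomorphic_rings TYPE('b) TYPE('a)"
proof -
  obtain f :: "'a \<Rightarrow> 'b" where f: "bij f" "\<And>x y. f (x + y) = f x + f y" "\<And>x y. f (x * y) = f x * f y"
    using assms by (auto simp: isomorphic_rings_def)
  have "inv f (u + v) = inv f u + inv f v" "inv f (u * v) = inv f u * inv f v" for u v
    using f by (metis bij_inv_eq_iff)+
  then show ?thesis
    unfolding isomorphic_rings_def using f(1) bij_imp_bij_inv by blast
qed

text \<open>The relations determine all sums and products of the four elements. Coefficients can be
  read off in \<open>E4\<close>, so the isomorphism \<open>g\<close> starts there and is inverted at
  the end.\<close>

lemma isomorphic_rings_E4I:
  fixes a b :: "'a::ring"
  assumes "a + a = 0" "b + b = 0" "a * a = a" "b * b = b" "a * b = a" "b * a = b"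
    and UNIV: "UNIV = {0, a, b, a + b}" and "distinct [0, a, b, a + b]"
  shows "isomorphic_rings TYPE('a) TYPE(E4)"
proof -
  define g where "g u = (case u of E4 p q \<Rightarrow> (if p = 1 then a else 0) + (if q = 1 then b else 0))" for u
  have g: "g (E4 0 0) = 0" "g (E4 1 0) = a" "g (E4 0 1) = b" "g (E4 1 1) = a + b"
    by (simp_all add: g_def)
  have cases4: "u = E4 0 0 \<or> u = E4 1 0 \<or> u = E4 0 1 \<or> u = E4 1 1" for u
    by (cases u) (metis (full_types) bit.exhaust)
  \<comment> \<open>Characteristic \<open>2\<close> in the right-nested form that sums have after
    sorting by \<open>ac_simps\<close>.\<close>
  have rel: "a + (a + x) = x" "b + (b + x) = x" for x
    using assms by (metis add.assoc add_0)+
  have "inj g"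
  proof (rule injI)
    fix u v assume "g u = g v"
    then show "u = v"
      using cases4[of u] cases4[of v] assms(8) by (elim disjE) (auto simp: g)
  qed
  moreover have "surj g"
    unfolding surj_def using UNIV g by (metis UNIV_I empty_iff insertE)
  moreover have "g (u + v) = g u + g v" "g (u * v) = g u * g v" for u v
    using cases4[of u] cases4[of v] assms(1-6)
    by (elim disjE; simp add: g rel distrib_left distrib_right ac_simps)+
  ultimately have "isomorphic_rings TYPE(E4) TYPE('a)"
    unfolding isomorphic_rings_def bij_def by blast
  then show ?thesis
    by (rule isomorphic_rings_sym)
qed

text \<open>\<open>F(4)\<close> is the opposite ring of \<open>E(4)\<close>, so the same map on
  coefficients works.\<close>

lemma isomorphic_rings_F4I:
  fixes a b :: "'a::ring"
  assumes "a + a = 0" "b + b = 0" "a * a = a" "b * b = b" "a * b = b" "b * a = a"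
    and UNIV: "UNIV = {0, a, b, a + b}" and "distinct [0, a, b, a + b]"
  shows "isomorphic_rings TYPE('a) TYPE(F4)"
proof -
  define g where "g u = (case u of F4 p q \<Rightarrow> (if p = 1 then a else 0) + (if q = 1 then b else 0))" for u
  have g: "g (F4 0 0) = 0" "g (F4 1 0) = a" "g (F4 0 1) = b" "g (F4 1 1) = a + b"
    by (simp_all add: g_def)
  have cases4: "u = F4 0 0 \<or> u = F4 1 0 \<or> u = F4 0 1 \<or> u = F4 1 1" for u
    by (cases u) (metis (full_types) bit.exhaust)
  have rel: "a + (a + x) = x" "b + (b + x) = x" for x
    using assms by (metis add.assoc add_0)+
  have "inj g"
  proof (rule injI)
    fix u v assume "g u = g v"
    then show "u = v"
      using cases4[of u] cases4[of v] assms(8) by (elim disjE) (auto simp: g)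
  qed
  moreover have "surj g"
    unfolding surj_def using UNIV g by (metis UNIV_I empty_iff insertE)
  moreover have "g (u + v) = g u + g v" "g (u * v) = g u * g v" for u v
    using cases4[of u] cases4[of v] assms(1-6)
    by (elim disjE; simp add: g rel distrib_left distrib_right ac_simps)+
  ultimately have "isomorphic_rings TYPE(F4) TYPE('a)"
    unfolding isomorphic_rings_def bij_def by blast
  then show ?thesis
    by (rule isomorphic_rings_sym)
qed

section \<open>Structure of a ring whose graph is a star\<close>

lemma E4_or_F4_if_commutators_eq:
  fixes r :: "'a::ring"
  assumes noncommutative: "\<exists>x y :: 'a. x * y \<noteq> y * x" and "r \<noteq> 0"
    and comm: "\<And>x y. x \<noteq> 0 \<Longrightarrow> y \<noteq> 0 \<Longrightarrow> x \<noteq> y \<Longrightarrow> commutator x y = r \<or> commutator x y = - r"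
  shows "isomorphic_rings TYPE('a) TYPE(E4) \<or> isomorphic_rings TYPE('a) TYPE(F4)"
proof -
  have centralizer: "y = 0 \<or> y = x" if "x \<noteq> 0" "x * y = y * x" for x y :: 'a
    using comm[of x y] that \<open>r \<noteq> 0\<close> by (auto simp: commutator_def)
  have char2: "x + x = 0" for x :: 'a
    using centralizer[of x "x + x"] by (cases "x = 0") (auto simp: algebra_simps)
  then have eq_iff: "x = y \<longleftrightarrow> x + y = 0" and minus: "- x = x" for x y :: 'a
    by (metis add_right_cancel, metis minus_unique)
  have square: "x * x = 0 \<or> x * x = x" for x :: 'a
    using centralizer[of x "x * x"] by (cases "x = 0") (auto simp: mult.assoc)
  have "\<exists>x :: 'a. x * x \<noteq> x"
  proof (rule ccontr)
    assume "\<not> ?thesis"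
    then have idem: "x * x = x" for x :: 'a
      by blast
    have "x * y = y * x" for x y :: 'a
    proof -
      have "x + y = (x + y) * (x + y)"
        by (simp only: idem)
      also have "\<dots> = (x + y) + (x * y + y * x)"
        by (simp add: distrib_left distrib_right idem[of x] idem[of y] ac_simps)
      finally have "x * y + y * x = 0"
        by simp
      then show ?thesis
        using eq_iff by blast
    qed
    then show False
      using noncommutative by blast
  qed
  then obtain x :: 'a where x: "x * x = 0" "x \<noteq> 0"
    using square by auto
  \<comment> \<open>A ring with no elements besides \<open>0\<close> and \<open>x\<close> would be
    commutative.\<close>
  obtain y :: 'a where y: "y \<noteq> 0" "y \<noteq> x"
    using noncommutative by (metis mult_zero_left mult_zero_right)
  then have ncomm: "x * y \<noteq> y * x"
    using centralizer x by blast
  have UNIV: "z \<in> {0, x, y, x + y}" for z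
  proof (rule ccontr)
    assume z: "z \<notin> {0, x, y, x + y}"
    have "commutator x (y + z) = commutator x y + commutator x z"
      by (simp add: commutator_def algebra_simps)
    also have "\<dots> = r + r"
      using comm[of x y] comm[of x z] x y z minus[of r] by auto
    finally have "x * (y + z) = (y + z) * x"
      by (simp add: char2 commutator_def)
    then have "y + z = 0 \<or> y + z = x"
      using centralizer x by blast
    \<comment> \<open>In characteristic \<open>2\<close> the two cases say \<open>z = y\<close> and
      \<open>z = x + y\<close>.\<close>
    then show False
      using z y char2 by (metis add.commute add.right_neutral add.assoc insertCI)
  qed
  \<comment> \<open>If \<open>x * y\<close> were \<open>y\<close> or \<open>x + y\<close>, left
    multiplication by \<open>x\<close> would fix it, so it would be \<open>0\<close>, which neither
    is. The same holds for \<open>y * x\<close> on the right.\<close>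
  have x_left: "x * (x * z) = 0" and x_right: "(z * x) * x = 0" for z
    using x by (metis mult.assoc mult_zero_left, metis mult.assoc mult_zero_right)
  have "x * y \<in> {0, x}"
  proof -
    have "x * y \<noteq> y"
      using x_left[of y] y by auto
    moreover have "x * y \<noteq> x + y"
    proof
      assume eq: "x * y = x + y"
      with x_left[of y] have "x * y = 0"
        by (simp add: distrib_left x)
      with eq y eq_iff[of x y] show False
        by simp
    qed
    ultimately show ?thesis
      using UNIV[of "x * y"] by blast
  qed
  moreover have "y * x \<in> {0, x}"
  proof -
    have "y * x \<noteq> y"
      using x_right[of y] y by auto
    moreover have "y * x \<noteq> x + y"
    proof
      assume eq: "y * x = x + y"
      with x_right[of y] have "y * x = 0"
        by (simp add: distrib_right x)
      with eq y eq_iff[of x y] show False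
        by simp
    qed
    ultimately show ?thesis
      using UNIV[of "y * x"] by blast
  qed
  ultimately have xy: "x * y = x \<and> y * x = 0 \<or> x * y = 0 \<and> y * x = x"
    using ncomm by auto
  \<comment> \<open>On one side \<open>y\<close> fixes \<open>x\<close>, hence so does
    \<open>y * y\<close>, while \<open>x \<noteq> 0\<close>.\<close>
  have "y * y \<noteq> 0"
    using xy x by (metis mult.assoc mult_zero_left mult_zero_right)
  then have yy: "y * y = y"
    using square by blast
  have add3: "x + (x + z) = z" "y + (x + y) = x" "y + (y + z) = z" for z
    using char2 by (metis add.assoc add_0, metis add.assoc add.commute add.right_neutral, metis add.assoc add_0)
  \<comment> \<open>\<open>x + y\<close> is idempotent because \<open>x * x = 0\<close> and
    \<open>x * y + y * x = x\<close>.\<close>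
  have gens: "y + y = 0" "(x + y) + (x + y) = 0" "y * y = y" "(x + y) * (x + y) = x + y"
    "UNIV = {0, y, x + y, y + (x + y)}" "distinct [0, y, x + y, y + (x + y)]"
    using char2 yy xy x y UNIV eq_iff[of x y]
    by (auto simp: add3 distrib_left distrib_right)
  show ?thesis
    using xy
  proof
    assume "x * y = x \<and> y * x = 0"
    then have "y * (x + y) = y" "(x + y) * y = x + y"
      by (simp_all add: distrib_left distrib_right yy)
    with gens show ?thesis
      using isomorphic_rings_E4I[of y "x + y"] by blast
  next
    assume "x * y = 0 \<and> y * x = x"
    then have "y * (x + y) = x + y" "(x + y) * y = y"
      by (simp_all add: distrib_left distrib_right yy)
    with gens show ?thesis
      using isomorphic_rings_F4I[of y "x + y"] by blast
  qed
qed

section \<open>Commutators in the two rings\<close>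

text \<open>The commutator is alternating and bilinear, so it is the determinant of the coefficients
  times \<open>a + b\<close>. Over the field of two elements, two vectors are independent exactly
  when they are nonzero and distinct.\<close>

lemma commutator_E4:
  fixes u v :: E4
  shows "commutator u v = (if u = 0 \<or> v = 0 \<or> u = v then 0 else E4 1 1)"
proof -
  obtain p q p' q' where "u = E4 p q" "v = E4 p' q'"
    by (metis E4.exhaust)
  then show ?thesis
    by (cases p; cases q; cases p'; cases q') (simp_all add: commutator_def zero_E4_def)
qed

lemma commutator_F4:
  fixes u v :: F4
  shows "commutator u v = (if u = 0 \<or> v = 0 \<or> u = v then 0 else F4 1 1)"
proof -
  obtain p q p' q' where "u = F4 p q" "v = F4 p' q'"
    by (metis F4.exhaust)
  then show ?thesis
    by (cases p; cases q; cases p'; cases q') (simp_all add: commutator_def zero_F4_def)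
qed

text \<open>An isomorphism preserves commutators. As \<open>r\<close> is a nonzero commutator, it
  goes to the only possible nonzero value \<open>c\<close>, and so does
  \<open>commutator x y\<close>.\<close>

lemma commutator_eq_if_isomorphic:
  fixes r :: "'a::ring" and c :: "'b::ring"
  assumes iso: "isomorphic_rings TYPE('a) TYPE('b)"
    and comm: "\<And>u v :: 'b. commutator u v = (if u = 0 \<or> v = 0 \<or> u = v then 0 else c)"
    and r: "r \<in> commutator_set" "r \<noteq> 0" and xy: "x \<noteq> 0" "y \<noteq> 0" "x \<noteq> y"
  shows "commutator x y = r"
proof -
  obtain f :: "'a \<Rightarrow> 'b" where f: "bij f"
    and add: "\<And>x y. f (x + y) = f x + f y" and mult: "\<And>x y. f (x * y) = f x * f y"
    using iso by (auto simp: isomorphic_rings_def)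
  have inj: "f u = f v \<longleftrightarrow> u = v" for u v
    using f by (simp add: bij_is_inj inj_eq)
  have zero: "f 0 = 0"
    using add[of 0 0] by simp
  have f_comm: "f (commutator u v) = commutator (f u) (f v)" for u v
    by (metis add commutator_def eq_diff_eq mult)
  have f_zero: "f u = 0 \<longleftrightarrow> u = 0" for u
    using inj[of u 0] zero by simp
  obtain u v where uv: "r = commutator u v"
    using r(1) by (auto simp: commutator_set_def)
  have "f r = c"
    using r(2) comm[of "f u" "f v"] by (auto simp: uv f_comm simp flip: f_zero split: if_splits)
  moreover have "f (commutator x y) = c"
    using xy comm[of "f x" "f y"] by (simp add: f_comm f_zero inj)
  ultimately show ?thesis
    using inj by metis
qed

theorem proposition2p5:
  fixes r :: "'a::{ring, finite}"
  assumes noncommutative: "\<exists>x y :: 'a. x * y \<noteq> y * x"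
    and r: "r \<in> commutator_set"
  shows "star_graph (with_proj (noncommuting_graph r)) \<longleftrightarrow>
    r \<noteq> 0 \<and> (isomorphic_rings TYPE('a) TYPE(E4) \<or> isomorphic_rings TYPE('a) TYPE(F4))"
proof -
  \<comment> \<open>The converse direction: the single nonzero commutator must be \<open>r\<close>,
    so no sign remains.\<close>
  have "commutator x y = r"
    if "r \<noteq> 0" "isomorphic_rings TYPE('a) TYPE(E4) \<or> isomorphic_rings TYPE('a) TYPE(F4)"
      "x \<noteq> 0" "y \<noteq> 0" "x \<noteq> y" for x y
    using that(2)
  proof
    assume "isomorphic_rings TYPE('a) TYPE(E4)"
    then show ?thesis
      by (rule commutator_eq_if_isomorphic[OF _ commutator_E4 r that(1,3-5)])
  next
    assume "isomorphic_rings TYPE('a) TYPE(F4)"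
    then show ?thesis
      by (rule commutator_eq_if_isomorphic[OF _ commutator_F4 r that(1,3-5)])
  qed
  then show ?thesis
    unfolding star_graph_noncommuting_graph_iff[OF noncommutative]
    using E4_or_F4_if_commutators_eq[OF noncommutative] by blast
qed

end
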